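(* sBIL is finitely algebraizable with respect to $\mathcal{BHA}$ with defining equations $\tau(x)=\{x=\top\}$ and equivalence formulas $\Delta(x,y)=\{x\leftrightarrow y\}$; that is, for all sets of formulas $\Gamma\cup\{\phi\}$ and all sets of equations $\Theta\cup\{\epsilon=\delta\}$: (ALG1) $\Gamma\vdash_s\phi$ iff $\tau(\Gamma)\models_{\mathcal{BHA}}\tau(\phi)$; (ALG2) $\Theta\models_{\mathcal{BHA}}\epsilon=\delta$ iff $\Delta(\Theta)\vdash_s\Delta(\epsilon,\delta)$; (ALG3) $\phi\vdash_s\Delta(\tau(\phi))$ and $\Delta(\tau(\phi))\vdash_s\phi$; (ALG4) $\epsilon=\delta\models_{\mathcal{BHA}}\tau(\Delta(\epsilon,\delta))$ and $\tau(\Delta(\epsilon,\delta))\models_{\mathcal{BHA}}\epsilon=\delta$.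
   Context: Fix a countably infinite set $\mathrm{Prop}$ of propositional variables. Bi-intuitionistic formulas are generated by $\phi ::= p \mid \bot \mid \top \mid \phi\wedge\phi \mid \phi\vee\phi \mid \phi\to\phi \mid \phi\prec\phi$ with $p\in\mathrm{Prop}$, where $\prec$ is the binary exclusion connective. Abbreviations: $\neg\phi := \phi\to\bot$, ${\sim}\phi := \top\prec\phi$, $\phi\leftrightarrow\psi := (\phi\to\psi)\wedge(\psi\to\phi)$. An axiom is any instance of: (A1) $\phi\to(\psi\to\phi)$; (A2) $(\phi\to(\psi\to\chi))\to((\phi\to\psi)\to(\phi\to\chi))$; (A3) $\phi\to(\phi\vee\psi)$; (A4) $\psi\to(\phi\vee\psi)$; (A5) $(\phi\to\chi)\to((\psi\to\chi)\to((\phi\vee\psi)\to\chi))$; (A6) $(\phi\wedge\psi)\to\phi$; (A7) $(\phi\wedge\psi)\to\psi$; (A8) $(\chi\to\phi)\to((\chi\to\psi)\to(\chi\to(\phi\wedge\psi)))$; (A9) $\bot\to\phi$; (A10) $\phi\to\top$; (A11) $\phi\to(\psi\vee(\phi\prec\psi))$; (A12) $(\phi\prec\psi)\to{\sim}(\phi\to\psi)$; (A13) $((\phi\prec\psi)\prec\chi)\to(\phi\prec(\psi\vee\chi))$; (A14) $\neg(\phi\prec\psi)\to(\phi\to\psi)$. The logic sBIL is the relation $\Gamma\vdash_s\phi$ that holds iff $\Gamma\vdash\phi$ is derivable with the rules: (Ax) $\Gamma\vdash\phi$ for any axiom $\phi$; (El) $\Gamma\vdash\phi$ if $\phi\in\Gamma$;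 (MP) from $\Gamma\vdash\phi$ and $\Gamma\vdash\phi\to\psi$ infer $\Gamma\vdash\psi$; (sDN) from $\Gamma\vdash\phi$ infer $\Gamma\vdash\neg{\sim}\phi$. For sets, $\Gamma\vdash_s\Delta$ means $\Gamma\vdash_s\delta$ for every $\delta\in\Delta$. A bi-Heyting algebra is an algebra $(A,\top,\bot,\wedge,\vee,\to,\prec)$ such that $(A,\top,\bot,\wedge,\vee)$ is a bounded lattice with order $a\le b$ iff $a=a\wedge b$, and for all $a,b,c$: $a\wedge b\le c\iff a\le b\to c$, and $a\le b\vee c\iff a\prec b\le c$. $\mathcal{BHA}$ is the class of all bi-Heyting algebras. A valuation $v:\mathrm{Prop}\to A$ extends to $\bar v$ on formulas by interpreting connectives as the corresponding operations. An equation is a pair of formulas written $\phi=\psi$; for a class $K$ of algebras and set of equations $\Theta$, $\Theta\models_K\phi=\psi$ means: for all $A\in K$ and valuations $v$ on $A$, if $\bar v(\theta)=\bar v(\eta)$ for all $(\theta=\eta)\in\Theta$ then $\bar v(\phi)=\bar v(\psi)$; for a set of equations on the right, $\models_K$ means each is entailed. Notation: $\tau(\phi)$ is $\tau(x)$ with $x$ replaced by $\phi$, $\tau(\Gamma)=\bigcup_{\gamma\in\Gamma}\tau(\gamma)$; $\Delta(\epsilon,\delta)$ is $\Delta(x,y)$ with $x,y$ replaced by $\epsilon,\delta$; $\Delta(\Theta)=\bigcup\{\Delta(\epsilon,\delta)\mid(\epsilon=\delta)\in\Theta\}$. *)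

theory Defs
  imports Main "HOL-Library.Countable_Set"
begin

datatype (fm_vars: 'p) fm =
    Var 'p
  | Bot ("\<^bold>\<bottom>")
  | Top ("\<^bold>\<top>")
  | Conj "'p fm" "'p fm" (infixr "\<^bold>\<and>" 68)
  | Disj "'p fm" "'p fm" (infixr "\<^bold>\<or>" 67)
  | Imp "'p fm" "'p fm" (infixr "\<^bold>\<rightarrow>" 66)
  | Excl "'p fm" "'p fm" (infixl "\<^bold>\<prec>" 69)

abbreviation Neg :: "'p fm \<Rightarrow> 'p fm" ("\<^bold>\<not> _" [70] 70)
  where "\<^bold>\<not> \<phi> \<equiv> \<phi> \<^bold>\<rightarrow> \<^bold>\<bottom>"

abbreviation CoNeg :: "'p fm \<Rightarrow> 'p fm" ("\<^bold>\<sim> _" [70] 70)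
  where "\<^bold>\<sim> \<phi> \<equiv> \<^bold>\<top> \<^bold>\<prec> \<phi>"

abbreviation Iff :: "'p fm \<Rightarrow> 'p fm \<Rightarrow> 'p fm" (infix "\<^bold>\<leftrightarrow>" 65)
  where "\<phi> \<^bold>\<leftrightarrow> \<psi> \<equiv> (\<phi> \<^bold>\<rightarrow> \<psi>) \<^bold>\<and> (\<psi> \<^bold>\<rightarrow> \<phi>)"

primrec subst :: "('p \<Rightarrow> 'q fm) \<Rightarrow> 'p fm \<Rightarrow> 'q fm" where
  "subst s (Var p) = s p"
| "subst s \<^bold>\<bottom> = \<^bold>\<bottom>"
| "subst s \<^bold>\<top> = \<^bold>\<top>"
| "subst s (\<phi> \<^bold>\<and> \<psi>) = subst s \<phi> \<^bold>\<and> subst s \<psi>"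
| "subst s (\<phi> \<^bold>\<or> \<psi>) = subst s \<phi> \<^bold>\<or> subst s \<psi>"
| "subst s (\<phi> \<^bold>\<rightarrow> \<psi>) = subst s \<phi> \<^bold>\<rightarrow> subst s \<psi>"
| "subst s (\<phi> \<^bold>\<prec> \<psi>) = subst s \<phi> \<^bold>\<prec> subst s \<psi>"

inductive bi_axiom :: "'p fm \<Rightarrow> bool" where
  A1: "bi_axiom (\<phi> \<^bold>\<rightarrow> (\<psi> \<^bold>\<rightarrow> \<phi>))"
| A2: "bi_axiom ((\<phi> \<^bold>\<rightarrow> (\<psi> \<^bold>\<rightarrow> \<chi>)) \<^bold>\<rightarrow> ((\<phi> \<^bold>\<rightarrow> \<psi>) \<^bold>\<rightarrow> (\<phi> \<^bold>\<rightarrow> \<chi>)))"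
| A3: "bi_axiom (\<phi> \<^bold>\<rightarrow> (\<phi> \<^bold>\<or> \<psi>))"
| A4: "bi_axiom (\<psi> \<^bold>\<rightarrow> (\<phi> \<^bold>\<or> \<psi>))"
| A5: "bi_axiom ((\<phi> \<^bold>\<rightarrow> \<chi>) \<^bold>\<rightarrow> ((\<psi> \<^bold>\<rightarrow> \<chi>) \<^bold>\<rightarrow> ((\<phi> \<^bold>\<or> \<psi>) \<^bold>\<rightarrow> \<chi>)))"
| A6: "bi_axiom ((\<phi> \<^bold>\<and> \<psi>) \<^bold>\<rightarrow> \<phi>)"
| A7: "bi_axiom ((\<phi> \<^bold>\<and> \<psi>) \<^bold>\<rightarrow> \<psi>)"
| A8: "bi_axiom ((\<chi> \<^bold>\<rightarrow> \<phi>) \<^bold>\<rightarrow> ((\<chi> \<^bold>\<rightarrow> \<psi>) \<^bold>\<rightarrow> (\<chi> \<^bold>\<rightarrow> (\<phi> \<^bold>\<and> \<psi>))))"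
| A9: "bi_axiom (\<^bold>\<bottom> \<^bold>\<rightarrow> \<phi>)"
| A10: "bi_axiom (\<phi> \<^bold>\<rightarrow> \<^bold>\<top>)"
| A11: "bi_axiom (\<phi> \<^bold>\<rightarrow> (\<psi> \<^bold>\<or> (\<phi> \<^bold>\<prec> \<psi>)))"
| A12: "bi_axiom ((\<phi> \<^bold>\<prec> \<psi>) \<^bold>\<rightarrow> \<^bold>\<sim> (\<phi> \<^bold>\<rightarrow> \<psi>))"
| A13: "bi_axiom (((\<phi> \<^bold>\<prec> \<psi>) \<^bold>\<prec> \<chi>) \<^bold>\<rightarrow> (\<phi> \<^bold>\<prec> (\<psi> \<^bold>\<or> \<chi>)))"
| A14: "bi_axiom (\<^bold>\<not> (\<phi> \<^bold>\<prec> \<psi>) \<^bold>\<rightarrow> (\<phi> \<^bold>\<rightarrow> \<psi>))"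

inductive sBIL :: "'p fm set \<Rightarrow> 'p fm \<Rightarrow> bool" (infix "\<turnstile>\<^sub>s" 50) where
  Ax: "bi_axiom \<phi> \<Longrightarrow> \<Gamma> \<turnstile>\<^sub>s \<phi>"
| El: "\<phi> \<in> \<Gamma> \<Longrightarrow> \<Gamma> \<turnstile>\<^sub>s \<phi>"
| MP: "\<Gamma> \<turnstile>\<^sub>s \<phi> \<Longrightarrow> \<Gamma> \<turnstile>\<^sub>s \<phi> \<^bold>\<rightarrow> \<psi> \<Longrightarrow> \<Gamma> \<turnstile>\<^sub>s \<psi>"
| sDN: "\<Gamma> \<turnstile>\<^sub>s \<phi> \<Longrightarrow> \<Gamma> \<turnstile>\<^sub>s \<^bold>\<not> (\<^bold>\<sim> \<phi>)"

record 'a bi_alg =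
  carrier :: "'a set"
  top_op :: 'a
  bot_op :: 'a
  meet_op :: "'a \<Rightarrow> 'a \<Rightarrow> 'a"
  join_op :: "'a \<Rightarrow> 'a \<Rightarrow> 'a"
  imp_op :: "'a \<Rightarrow> 'a \<Rightarrow> 'a"
  excl_op :: "'a \<Rightarrow> 'a \<Rightarrow> 'a"

definition alg_le :: "'a bi_alg \<Rightarrow> 'a \<Rightarrow> 'a \<Rightarrow> bool" where
  "alg_le A a b \<longleftrightarrow> a = meet_op A a b"

locale bi_heyting_algebra =
  fixes A :: "'a bi_alg"
  assumes top_closed: "top_op A \<in> carrier A"
    and bot_closed: "bot_op A \<in> carrier A"
    and meet_closed: "\<lbrakk>a \<in> carrier A; b \<in> carrier A\<rbrakk> \<Longrightarrow> meet_op A a b \<in> carrier A"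
    and join_closed: "\<lbrakk>a \<in> carrier A; b \<in> carrier A\<rbrakk> \<Longrightarrow> join_op A a b \<in> carrier A"
    and imp_closed: "\<lbrakk>a \<in> carrier A; b \<in> carrier A\<rbrakk> \<Longrightarrow> imp_op A a b \<in> carrier A"
    and excl_closed: "\<lbrakk>a \<in> carrier A; b \<in> carrier A\<rbrakk> \<Longrightarrow> excl_op A a b \<in> carrier A"
    and meet_comm: "\<lbrakk>a \<in> carrier A; b \<in> carrier A\<rbrakk> \<Longrightarrow> meet_op A a b = meet_op A b a"
    and join_comm: "\<lbrakk>a \<in> carrier A; b \<in> carrier A\<rbrakk> \<Longrightarrow> join_op A a b = join_op A b a"
    and meet_assoc: "\<lbrakk>a \<in> carrier A; b \<in> carrier A; c \<in> carrier A\<rbrakk> \<Longrightarrow>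
      meet_op A (meet_op A a b) c = meet_op A a (meet_op A b c)"
    and join_assoc: "\<lbrakk>a \<in> carrier A; b \<in> carrier A; c \<in> carrier A\<rbrakk> \<Longrightarrow>
      join_op A (join_op A a b) c = join_op A a (join_op A b c)"
    and meet_absorb: "\<lbrakk>a \<in> carrier A; b \<in> carrier A\<rbrakk> \<Longrightarrow> meet_op A a (join_op A a b) = a"
    and join_absorb: "\<lbrakk>a \<in> carrier A; b \<in> carrier A\<rbrakk> \<Longrightarrow> join_op A a (meet_op A a b) = a"
    and le_top: "a \<in> carrier A \<Longrightarrow> alg_le A a (top_op A)"
    and bot_le: "a \<in> carrier A \<Longrightarrow> alg_le A (bot_op A) a"
    and imp_residual: "\<lbrakk>a \<in> carrier A; b \<in> carrier A; c \<in> carrier A\<rbrakk> \<Longrightarrow>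
      alg_le A (meet_op A a b) c \<longleftrightarrow> alg_le A a (imp_op A b c)"
    and excl_residual: "\<lbrakk>a \<in> carrier A; b \<in> carrier A; c \<in> carrier A\<rbrakk> \<Longrightarrow>
      alg_le A a (join_op A b c) \<longleftrightarrow> alg_le A (excl_op A a b) c"

text \<open>The class of all bi-Heyting algebras whose carrier is a subset of the type
  \<^typ>\<open>'a\<close>. Since HOL has no quantifier over types, the class of all bi-Heyting algebras
  is rendered by leaving \<^typ>\<open>'a\<close> a free type variable: every bi-Heyting algebra is
  isomorphic to a member of \<open>BHA\<close> at some infinite type.\<close>

definition BHA :: "'a bi_alg set" where
  "BHA = {A. bi_heyting_algebra A}"

primrec eval_fm :: "'a bi_alg \<Rightarrow> ('p \<Rightarrow> 'a) \<Rightarrow> 'p fm \<Rightarrow> 'a" where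
  "eval_fm A v (Var p) = v p"
| "eval_fm A v \<^bold>\<bottom> = bot_op A"
| "eval_fm A v \<^bold>\<top> = top_op A"
| "eval_fm A v (\<phi> \<^bold>\<and> \<psi>) = meet_op A (eval_fm A v \<phi>) (eval_fm A v \<psi>)"
| "eval_fm A v (\<phi> \<^bold>\<or> \<psi>) = join_op A (eval_fm A v \<phi>) (eval_fm A v \<psi>)"
| "eval_fm A v (\<phi> \<^bold>\<rightarrow> \<psi>) = imp_op A (eval_fm A v \<phi>) (eval_fm A v \<psi>)"
| "eval_fm A v (\<phi> \<^bold>\<prec> \<psi>) = excl_op A (eval_fm A v \<phi>) (eval_fm A v \<psi>)"

type_synonym 'p equation = "'p fm \<times> 'p fm"

definition entails :: "'a bi_alg set \<Rightarrow> 'p equation set \<Rightarrow> 'p equation \<Rightarrow> bool" where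
  "entails K \<Theta> e \<longleftrightarrow>
    (\<forall>A\<in>K. \<forall>v. (\<forall>p. v p \<in> carrier A) \<longrightarrow>
      (\<forall>(\<theta>, \<eta>)\<in>\<Theta>. eval_fm A v \<theta> = eval_fm A v \<eta>) \<longrightarrow>
      eval_fm A v (fst e) = eval_fm A v (snd e))"

definition entails_set :: "'a bi_alg set \<Rightarrow> 'p equation set \<Rightarrow> 'p equation set \<Rightarrow> bool" where
  "entails_set K \<Theta> E \<longleftrightarrow> (\<forall>e\<in>E. entails K \<Theta> e)"

definition derives_set :: "('p fm set \<Rightarrow> 'p fm \<Rightarrow> bool) \<Rightarrow> 'p fm set \<Rightarrow> 'p fm set \<Rightarrow> bool" where
  "derives_set L \<Gamma> D \<longleftrightarrow> (\<forall>\<delta>\<in>D. L \<Gamma> \<delta>)"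

text \<open>A set of equations \<open>\<tau>(x)\<close> and a set of formulas \<open>\<Delta>(x,y)\<close> are given together with
  their distinguished variables, which are then (simultaneously) replaced by formulas.\<close>

definition inst_eqs :: "'p \<Rightarrow> 'p equation set \<Rightarrow> 'p fm \<Rightarrow> 'p equation set" where
  "inst_eqs x \<tau> \<phi> = (\<lambda>(l, r). (subst (Var(x := \<phi>)) l, subst (Var(x := \<phi>)) r)) ` \<tau>"

definition inst_eqs_set :: "'p \<Rightarrow> 'p equation set \<Rightarrow> 'p fm set \<Rightarrow> 'p equation set" where
  "inst_eqs_set x \<tau> \<Gamma> = (\<Union>\<gamma>\<in>\<Gamma>. inst_eqs x \<tau> \<gamma>)"

definition inst_fms :: "'p \<Rightarrow> 'p \<Rightarrow> 'p fm set \<Rightarrow> 'p fm \<Rightarrow> 'p fm \<Rightarrow> 'p fm set" where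
  "inst_fms x y D \<epsilon> \<delta> = subst (Var(x := \<epsilon>, y := \<delta>)) ` D"

definition inst_fms_set :: "'p \<Rightarrow> 'p \<Rightarrow> 'p fm set \<Rightarrow> 'p equation set \<Rightarrow> 'p fm set" where
  "inst_fms_set x y D \<Theta> = (\<Union>(\<epsilon>, \<delta>)\<in>\<Theta>. inst_fms x y D \<epsilon> \<delta>)"

definition finitely_algebraizable ::
  "('p fm set \<Rightarrow> 'p fm \<Rightarrow> bool) \<Rightarrow> 'a bi_alg set \<Rightarrow> 'p \<Rightarrow> 'p \<Rightarrow>
    'p equation set \<Rightarrow> 'p fm set \<Rightarrow> bool" where
  "finitely_algebraizable L K x y \<tau> D \<longleftrightarrow>
    x \<noteq> y \<and>
    finite \<tau> \<and> (\<forall>(l, r)\<in>\<tau>. fm_vars l \<union> fm_vars r \<subseteq> {x}) \<and>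
    finite D \<and> (\<forall>\<chi>\<in>D. fm_vars \<chi> \<subseteq> {x, y}) \<and>
    (\<forall>\<Gamma> \<phi>. L \<Gamma> \<phi> \<longleftrightarrow> entails_set K (inst_eqs_set x \<tau> \<Gamma>) (inst_eqs x \<tau> \<phi>)) \<and>
    (\<forall>\<Theta> \<epsilon> \<delta>. entails K \<Theta> (\<epsilon>, \<delta>) \<longleftrightarrow>
      derives_set L (inst_fms_set x y D \<Theta>) (inst_fms x y D \<epsilon> \<delta>)) \<and>
    (\<forall>\<phi>. derives_set L {\<phi>} (inst_fms_set x y D (inst_eqs x \<tau> \<phi>)) \<and>
      L (inst_fms_set x y D (inst_eqs x \<tau> \<phi>)) \<phi>) \<and>
    (\<forall>\<epsilon> \<delta>. entails_set K {(\<epsilon>, \<delta>)} (inst_eqs_set x \<tau> (inst_fms x y D \<epsilon> \<delta>)) \<and>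
      entails K (inst_eqs_set x \<tau> (inst_fms x y D \<epsilon> \<delta>)) (\<epsilon>, \<delta>))"

end

theory Submission
  imports Defs
begin

text \<open>
  Soundness is the verification that the elements equal to the top of a bi-Heyting algebra
  contain all axioms and are closed under both rules. Conversely, provable implication relative
  to \<open>\<Gamma>\<close> preorders the formulas. The double-negation rule together with A12, A13 and A14 yields
  the exclusion half of the residuation laws, so the quotient of the formulas is a bi-Heyting
  algebra in which exactly the consequences of \<open>\<Gamma>\<close> are equal to the top. It is countable, hence
  it has a copy inside any infinite type. The remaining conditions follow, because in a
  bi-Heyting algebra \<open>a \<leftrightarrow> b\<close> is the top precisely when \<open>a = b\<close>.
\<close>

section \<open>Bi-Heyting algebras\<close>

context bi_heyting_algebra
begin

declare top_closed [simp, intro] bot_closed [simp, intro] meet_closed [simp, intro]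
  join_closed [simp, intro] imp_closed [simp, intro] excl_closed [simp, intro]

abbreviation le (infix "\<sqsubseteq>" 50) where "a \<sqsubseteq> b \<equiv> alg_le A a b"

section \<open>Lattice order from the equational laws\<close>

lemma meet_idem: "a \<in> carrier A \<Longrightarrow> meet_op A a a = a"
  by (metis join_absorb meet_absorb meet_closed)

lemma le_refl [simp]: "a \<in> carrier A \<Longrightarrow> a \<sqsubseteq> a"
  by (simp add: alg_le_def meet_idem)

lemma le_antisym: "\<lbrakk>a \<in> carrier A; b \<in> carrier A; a \<sqsubseteq> b; b \<sqsubseteq> a\<rbrakk> \<Longrightarrow> a = b"
  by (metis alg_le_def meet_comm)

lemma le_trans: "\<lbrakk>a \<in> carrier A; b \<in> carrier A; c \<in> carrier A; a \<sqsubseteq> b; b \<sqsubseteq> c\<rbrakk> \<Longrightarrow> a \<sqsubseteq> c"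
  by (metis alg_le_def meet_assoc)

lemma meet_le1: "\<lbrakk>a \<in> carrier A; b \<in> carrier A\<rbrakk> \<Longrightarrow> meet_op A a b \<sqsubseteq> a"
  unfolding alg_le_def by (metis meet_assoc meet_comm meet_idem meet_closed)

lemma meet_le2: "\<lbrakk>a \<in> carrier A; b \<in> carrier A\<rbrakk> \<Longrightarrow> meet_op A a b \<sqsubseteq> b"
  by (metis meet_comm meet_le1)

lemma le_meetI:
  "\<lbrakk>a \<in> carrier A; b \<in> carrier A; c \<in> carrier A; c \<sqsubseteq> a; c \<sqsubseteq> b\<rbrakk> \<Longrightarrow> c \<sqsubseteq> meet_op A a b"
  by (metis alg_le_def meet_assoc)

lemma le_iff_join:
  "\<lbrakk>a \<in> carrier A; b \<in> carrier A\<rbrakk> \<Longrightarrow> a \<sqsubseteq> b \<longleftrightarrow> join_op A a b = b"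
  by (metis alg_le_def join_absorb join_comm meet_absorb meet_comm)

lemma join_ge1: "\<lbrakk>a \<in> carrier A; b \<in> carrier A\<rbrakk> \<Longrightarrow> a \<sqsubseteq> join_op A a b"
  by (simp add: alg_le_def meet_absorb)

lemma join_ge2: "\<lbrakk>a \<in> carrier A; b \<in> carrier A\<rbrakk> \<Longrightarrow> b \<sqsubseteq> join_op A a b"
  by (metis join_comm join_ge1)

lemma join_leI:
  "\<lbrakk>a \<in> carrier A; b \<in> carrier A; c \<in> carrier A; a \<sqsubseteq> c; b \<sqsubseteq> c\<rbrakk> \<Longrightarrow> join_op A a b \<sqsubseteq> c"
  by (metis join_assoc join_closed le_iff_join)

text \<open>Residuation with the top as left factor. It turns the soundness of an implicational
  axiom into an inequality.\<close>

lemma imp_eq_top_iff: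
  assumes "a \<in> carrier A" "b \<in> carrier A"
  shows "imp_op A a b = top_op A \<longleftrightarrow> a \<sqsubseteq> b"
proof -
  have "meet_op A (top_op A) a = a"
    using assms by (metis alg_le_def le_top meet_comm top_closed)
  then have "a \<sqsubseteq> b \<longleftrightarrow> top_op A \<sqsubseteq> imp_op A a b"
    using imp_residual[of "top_op A" a b] assms by simp
  then show ?thesis
    using assms by (metis imp_closed le_antisym le_refl le_top top_closed)
qed

text \<open>Antisymmetry of the order read through the biconditional. This lets a formula replace an
  equation, the algebraic core of ALG2 to ALG4.\<close>

lemma iff_eq_top_iff:
  assumes "a \<in> carrier A" "b \<in> carrier A"
  shows "meet_op A (imp_op A a b) (imp_op A b a) = top_op A \<longleftrightarrow> a = b"
proof
  assume e: "meet_op A (imp_op A a b) (imp_op A b a) = top_op A"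
  have "top_op A \<sqsubseteq> imp_op A a b" "top_op A \<sqsubseteq> imp_op A b a"
    using assms meet_le1[of "imp_op A a b" "imp_op A b a"]
      meet_le2[of "imp_op A a b" "imp_op A b a"] by (simp_all add: e)
  then have "imp_op A a b = top_op A" "imp_op A b a = top_op A"
    using assms by (simp_all add: le_antisym le_top)
  then show "a = b" using assms by (simp add: imp_eq_top_iff le_antisym)
next
  assume "a = b"
  moreover have "imp_op A b b = top_op A" using assms by (simp add: imp_eq_top_iff)
  ultimately show "meet_op A (imp_op A a b) (imp_op A b a) = top_op A"
    by (simp add: meet_idem)
qed

section \<open>Inequalities behind the axioms\<close>

lemma modus_ponens:
  assumes "a \<in> carrier A" "b \<in> carrier A"
  shows "meet_op A (imp_op A a b) a \<sqsubseteq> b"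
  using assms by (simp add: imp_residual)

lemma le_join_excl:
  assumes "a \<in> carrier A" "b \<in> carrier A"
  shows "a \<sqsubseteq> join_op A b (excl_op A a b)"
  using assms by (simp add: excl_residual)

text \<open>Distributivity in disguise: residuation moves \<open>c\<close> to the right-hand side,
  where the join is a least upper bound.\<close>

lemma meet_join_leI:
  assumes "a \<in> carrier A" "b \<in> carrier A" "c \<in> carrier A" "d \<in> carrier A"
    and "meet_op A a c \<sqsubseteq> d" "meet_op A b c \<sqsubseteq> d"
  shows "meet_op A (join_op A a b) c \<sqsubseteq> d"
  using assms by (simp add: imp_residual join_leI)

lemma eval_closed [simp]:
  "(\<And>p. v p \<in> carrier A) \<Longrightarrow> eval_fm A v \<phi> \<in> carrier A"
  by (induction \<phi>) auto

text \<open>For A12: the top lies below \<open>?i\<close> joined with its co-negation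
  \<open>?n\<close>, so \<open>a\<close> may be split along this join. The part under
  \<open>?i\<close> is below \<open>b\<close> by modus ponens, the other below \<open>?n\<close>;
  residuating gives the claim.\<close>

lemma excl_le_coneg_imp:
  assumes [simp]: "a \<in> carrier A" "b \<in> carrier A"
  shows "excl_op A a b \<sqsubseteq> excl_op A (top_op A) (imp_op A a b)"
proof -
  let ?i = "imp_op A a b" and ?n = "excl_op A (top_op A) (imp_op A a b)"
  have "meet_op A (join_op A ?i ?n) a \<sqsubseteq> join_op A b ?n"
  proof (rule meet_join_leI)
    show "meet_op A ?i a \<sqsubseteq> join_op A b ?n"
      using le_trans[OF _ _ _ modus_ponens[of a b] join_ge1[of b ?n]] by simp
    show "meet_op A ?n a \<sqsubseteq> join_op A b ?n"
      using le_trans[OF _ _ _ meet_le1[of ?n a] join_ge2[of b ?n]] by simp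
  qed simp_all
  moreover have "a \<sqsubseteq> join_op A ?i ?n"
    using le_trans[OF _ _ _ le_top[of a] le_join_excl[of "top_op A" ?i]] by simp
  then have "a \<sqsubseteq> meet_op A (join_op A ?i ?n) a"
    by (intro le_meetI) simp_all
  ultimately have "a \<sqsubseteq> join_op A b ?n"
    using le_trans[of a "meet_op A (join_op A ?i ?n) a" "join_op A b ?n"] by simp
  then show ?thesis by (simp add: excl_residual)
qed

text \<open>For A13: residuating twice and reassociating the joins leaves an instance of
  \<open>le_join_excl\<close>.\<close>

lemma excl_excl_le:
  assumes [simp]: "a \<in> carrier A" "b \<in> carrier A" "c \<in> carrier A"
  shows "excl_op A (excl_op A a b) c \<sqsubseteq> excl_op A a (join_op A b c)"
  using le_join_excl[of a "join_op A b c"]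
  by (simp add: excl_residual[symmetric] join_assoc)

text \<open>For A14: \<open>a\<close> is below \<open>b\<close> joined with \<open>?e\<close>, and
  meeting with the negation \<open>?n\<close> of \<open>?e\<close> reduces the second joinand to the
  bottom.\<close>

lemma neg_excl_le:
  assumes [simp]: "a \<in> carrier A" "b \<in> carrier A"
  shows "imp_op A (excl_op A a b) (bot_op A) \<sqsubseteq> imp_op A a b"
proof -
  let ?e = "excl_op A a b"
  let ?n = "imp_op A ?e (bot_op A)"
  have "meet_op A (join_op A b ?e) ?n \<sqsubseteq> b"
  proof (rule meet_join_leI)
    show "meet_op A b ?n \<sqsubseteq> b" by (simp add: meet_le1)
    have "meet_op A ?n ?e \<sqsubseteq> b"
      using le_trans[OF _ _ _ modus_ponens[of ?e "bot_op A"] bot_le[of b]] by simp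
    then show "meet_op A ?e ?n \<sqsubseteq> b" using meet_comm[of ?e ?n] by simp
  qed simp_all
  then have "join_op A b ?e \<sqsubseteq> imp_op A ?n b" by (simp add: imp_residual)
  then have "a \<sqsubseteq> imp_op A ?n b"
    using le_trans[OF _ _ _ le_join_excl[of a b]] by simp
  then have "meet_op A a ?n \<sqsubseteq> b" by (simp add: imp_residual)
  then show ?thesis using meet_comm[of a ?n] by (simp add: imp_residual[symmetric])
qed

lemma le_modus_ponens:
  assumes "a \<in> carrier A" "b \<in> carrier A" "d \<in> carrier A"
    and "d \<sqsubseteq> a" "d \<sqsubseteq> imp_op A a b"
  shows "d \<sqsubseteq> b"
  using assms le_trans[OF _ _ _ le_meetI[of "imp_op A a b" a d] modus_ponens[of a b]] by simp

section \<open>Soundness of the axioms and rules\<close>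

lemma bi_axiom_eq_top:
  assumes "bi_axiom \<phi>" and v: "\<And>p. v p \<in> carrier A"
  shows "eval_fm A v \<phi> = top_op A"
  using assms(1)
proof cases
  case (A1 \<alpha> \<beta>)
  then show ?thesis using v by (simp add: imp_eq_top_iff imp_residual[symmetric] meet_le1)
next
  case (A2 \<alpha> \<beta> \<chi>)
  define a b c where "a = eval_fm A v \<alpha>" and "b = eval_fm A v \<beta>" and "c = eval_fm A v \<chi>"
  have [simp]: "a \<in> carrier A" "b \<in> carrier A" "c \<in> carrier A"
    by (simp_all add: a_def b_def c_def v)
  let ?p = "imp_op A a (imp_op A b c)" and ?q = "imp_op A a b"
  \<comment> \<open>\<open>?d\<close> collects the three nested antecedents of A2; after residuation
    the axiom says that \<open>?d\<close> is below \<open>c\<close>.\<close>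
  let ?d = "meet_op A (meet_op A ?p ?q) a"
  have pq: "?d \<sqsubseteq> meet_op A ?p ?q" and da: "?d \<sqsubseteq> a" by (simp_all add: meet_le1 meet_le2)
  have "?d \<sqsubseteq> ?p" using le_trans[OF _ _ _ pq meet_le1] by simp
  moreover have "?d \<sqsubseteq> ?q" using le_trans[OF _ _ _ pq meet_le2] by simp
  ultimately have "?d \<sqsubseteq> c"
    using da le_modus_ponens[of a b ?d] le_modus_ponens[of a "imp_op A b c" ?d]
      le_modus_ponens[of b c ?d] by simp
  then show ?thesis using v A2
    by (simp add: imp_eq_top_iff imp_residual[symmetric] a_def b_def c_def)
next
  case (A3 \<alpha> \<beta>)
  then show ?thesis using v by (simp add: imp_eq_top_iff join_ge1)
next
  case (A4 \<alpha> \<beta>)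
  then show ?thesis using v by (simp add: imp_eq_top_iff join_ge2)
next
  case (A5 \<alpha> \<chi> \<beta>)
  define a b c where "a = eval_fm A v \<alpha>" and "b = eval_fm A v \<beta>" and "c = eval_fm A v \<chi>"
  have [simp]: "a \<in> carrier A" "b \<in> carrier A" "c \<in> carrier A"
    by (simp_all add: a_def b_def c_def v)
  let ?p = "imp_op A a c" and ?q = "imp_op A b c"
  let ?d = "meet_op A ?p ?q"
  have "?d \<sqsubseteq> ?p" "?d \<sqsubseteq> ?q" by (simp_all add: meet_le1 meet_le2)
  then have "meet_op A a ?d \<sqsubseteq> c" "meet_op A b ?d \<sqsubseteq> c"
    using meet_comm[of a ?d] meet_comm[of b ?d] by (simp_all add: imp_residual)
  then have "meet_op A (join_op A a b) ?d \<sqsubseteq> c" by (simp add: meet_join_leI)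
  then have "meet_op A ?d (join_op A a b) \<sqsubseteq> c"
    using meet_comm[of "join_op A a b" ?d] by simp
  then show ?thesis using v A5
    by (simp add: imp_eq_top_iff imp_residual[symmetric] a_def b_def c_def)
next
  case (A6 \<alpha> \<beta>)
  then show ?thesis using v by (simp add: imp_eq_top_iff meet_le1)
next
  case (A7 \<alpha> \<beta>)
  then show ?thesis using v by (simp add: imp_eq_top_iff meet_le2)
next
  case (A8 \<chi> \<alpha> \<beta>)
  define a b c where "a = eval_fm A v \<alpha>" and "b = eval_fm A v \<beta>" and "c = eval_fm A v \<chi>"
  have [simp]: "a \<in> carrier A" "b \<in> carrier A" "c \<in> carrier A"
    by (simp_all add: a_def b_def c_def v)
  let ?p = "imp_op A c a" and ?q = "imp_op A c b"
  let ?d = "meet_op A ?p ?q"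
  have "?d \<sqsubseteq> ?p" "?d \<sqsubseteq> ?q" by (simp_all add: meet_le1 meet_le2)
  then have "meet_op A ?d c \<sqsubseteq> a" "meet_op A ?d c \<sqsubseteq> b" by (simp_all add: imp_residual)
  then have "meet_op A ?d c \<sqsubseteq> meet_op A a b" by (simp add: le_meetI)
  then show ?thesis using v A8
    by (simp add: imp_eq_top_iff imp_residual[symmetric] a_def b_def c_def)
next
  case (A9 \<alpha>)
  then show ?thesis using v by (simp add: imp_eq_top_iff bot_le)
next
  case (A10 \<alpha>)
  then show ?thesis using v by (simp add: imp_eq_top_iff le_top)
next
  case (A11 \<alpha> \<beta>)
  then show ?thesis using v by (simp add: imp_eq_top_iff le_join_excl)
next
  case (A12 \<alpha> \<beta>)
  then show ?thesis using v by (simp add: imp_eq_top_iff excl_le_coneg_imp)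
next
  case (A13 \<alpha> \<beta> \<chi>)
  then show ?thesis using v by (simp add: imp_eq_top_iff excl_excl_le)
next
  case (A14 \<alpha> \<beta>)
  then show ?thesis using v by (simp add: imp_eq_top_iff neg_excl_le)
qed

lemma sBIL_sound:
  assumes "\<Gamma> \<turnstile>\<^sub>s \<phi>" and v: "\<And>p. v p \<in> carrier A"
    and "\<And>\<gamma>. \<gamma> \<in> \<Gamma> \<Longrightarrow> eval_fm A v \<gamma> = top_op A"
  shows "eval_fm A v \<phi> = top_op A"
  using assms(1,3)
proof (induction rule: sBIL.induct)
  case (Ax \<phi> \<Gamma>)
  then show ?case using v by (simp add: bi_axiom_eq_top)
next
  case (El \<phi> \<Gamma>)
  then show ?case by blast
next
  case (MP \<Gamma> \<phi> \<psi>)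
  then have "top_op A \<sqsubseteq> eval_fm A v \<psi>"
    using v by (simp add: imp_eq_top_iff)
  then show ?case using v le_antisym le_top by simp
next
  case (sDN \<Gamma> \<phi>)
  \<comment> \<open>By exclusion residuation this says that the co-negation of the top is below the
    bottom, which is all that \<open>sDN\<close> needs once the premise evaluates to the
    top.\<close>
  have "top_op A \<sqsubseteq> join_op A (top_op A) (bot_op A)" by (simp add: join_ge1)
  then show ?case using sDN v by (simp add: imp_eq_top_iff excl_residual)
qed

end

section \<open>Provable implication as a residuated preorder\<close>

context
  fixes \<Gamma> :: "'p fm set"
begin

section \<open>Derived rules and the two residuation laws\<close>

lemma imp_weaken: "\<Gamma> \<turnstile>\<^sub>s \<phi> \<Longrightarrow> \<Gamma> \<turnstile>\<^sub>s \<psi> \<^bold>\<rightarrow> \<phi>"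
  by (meson A1 Ax MP)

lemma imp_distrib: "\<lbrakk>\<Gamma> \<turnstile>\<^sub>s \<phi> \<^bold>\<rightarrow> (\<psi> \<^bold>\<rightarrow> \<chi>); \<Gamma> \<turnstile>\<^sub>s \<phi> \<^bold>\<rightarrow> \<psi>\<rbrakk> \<Longrightarrow> \<Gamma> \<turnstile>\<^sub>s \<phi> \<^bold>\<rightarrow> \<chi>"
  by (meson A2 Ax MP)

lemma imp_trans: "\<lbrakk>\<Gamma> \<turnstile>\<^sub>s \<phi> \<^bold>\<rightarrow> \<psi>; \<Gamma> \<turnstile>\<^sub>s \<psi> \<^bold>\<rightarrow> \<chi>\<rbrakk> \<Longrightarrow> \<Gamma> \<turnstile>\<^sub>s \<phi> \<^bold>\<rightarrow> \<chi>"
  by (meson imp_weaken imp_distrib)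

lemma imp_refl: "\<Gamma> \<turnstile>\<^sub>s \<phi> \<^bold>\<rightarrow> \<phi>"
  \<comment> \<open>The combinator identity S K K: both premises are instances of A1.\<close>
  by (rule imp_distrib[where \<psi> = "\<phi> \<^bold>\<rightarrow> \<phi>"]) (rule Ax, rule A1)+

lemma conj_imp1: "\<Gamma> \<turnstile>\<^sub>s \<phi> \<^bold>\<and> \<psi> \<^bold>\<rightarrow> \<phi>"
  and conj_imp2: "\<Gamma> \<turnstile>\<^sub>s \<phi> \<^bold>\<and> \<psi> \<^bold>\<rightarrow> \<psi>"
  by (rule Ax, rule bi_axiom.intros)+

lemma imp_conjI: "\<lbrakk>\<Gamma> \<turnstile>\<^sub>s \<chi> \<^bold>\<rightarrow> \<phi>; \<Gamma> \<turnstile>\<^sub>s \<chi> \<^bold>\<rightarrow> \<psi>\<rbrakk> \<Longrightarrow> \<Gamma> \<turnstile>\<^sub>s \<chi> \<^bold>\<rightarrow> \<phi> \<^bold>\<and> \<psi>"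
  by (meson A8 Ax MP)

lemma imp_disj1: "\<Gamma> \<turnstile>\<^sub>s \<phi> \<^bold>\<rightarrow> \<phi> \<^bold>\<or> \<psi>"
  and imp_disj2: "\<Gamma> \<turnstile>\<^sub>s \<psi> \<^bold>\<rightarrow> \<phi> \<^bold>\<or> \<psi>"
  by (rule Ax, rule bi_axiom.intros)+

lemma disj_impI: "\<lbrakk>\<Gamma> \<turnstile>\<^sub>s \<phi> \<^bold>\<rightarrow> \<chi>; \<Gamma> \<turnstile>\<^sub>s \<psi> \<^bold>\<rightarrow> \<chi>\<rbrakk> \<Longrightarrow> \<Gamma> \<turnstile>\<^sub>s \<phi> \<^bold>\<or> \<psi> \<^bold>\<rightarrow> \<chi>"
  by (meson A5 Ax MP)

lemma imp_residuated: "\<Gamma> \<turnstile>\<^sub>s \<phi> \<^bold>\<and> \<psi> \<^bold>\<rightarrow> \<chi> \<longleftrightarrow> \<Gamma> \<turnstile>\<^sub>s \<phi> \<^bold>\<rightarrow> (\<psi> \<^bold>\<rightarrow> \<chi>)"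
proof
  assume "\<Gamma> \<turnstile>\<^sub>s \<phi> \<^bold>\<and> \<psi> \<^bold>\<rightarrow> \<chi>"
  then have *: "\<Gamma> \<turnstile>\<^sub>s (\<psi> \<^bold>\<rightarrow> \<phi> \<^bold>\<and> \<psi>) \<^bold>\<rightarrow> (\<psi> \<^bold>\<rightarrow> \<chi>)"
    by (meson A2 Ax MP imp_weaken)
  \<comment> \<open>A1 feeds the first antecedent of A8, taken with the common antecedent \<psi>.
    Discharging the trivial second antecedent then gives pairing.\<close>
  have "\<Gamma> \<turnstile>\<^sub>s \<phi> \<^bold>\<rightarrow> ((\<psi> \<^bold>\<rightarrow> \<psi>) \<^bold>\<rightarrow> (\<psi> \<^bold>\<rightarrow> \<phi> \<^bold>\<and> \<psi>))"
    by (meson A1 A8 Ax imp_trans)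
  then have "\<Gamma> \<turnstile>\<^sub>s \<phi> \<^bold>\<rightarrow> (\<psi> \<^bold>\<rightarrow> \<phi> \<^bold>\<and> \<psi>)"
    by (meson imp_distrib imp_refl imp_weaken)
  then show "\<Gamma> \<turnstile>\<^sub>s \<phi> \<^bold>\<rightarrow> (\<psi> \<^bold>\<rightarrow> \<chi>)" using * imp_trans by blast
next
  assume "\<Gamma> \<turnstile>\<^sub>s \<phi> \<^bold>\<rightarrow> (\<psi> \<^bold>\<rightarrow> \<chi>)"
  then show "\<Gamma> \<turnstile>\<^sub>s \<phi> \<^bold>\<and> \<psi> \<^bold>\<rightarrow> \<chi>" by (meson conj_imp1 conj_imp2 imp_distrib imp_trans)
qed

text \<open>Forward, \<open>sDN\<close> makes the co-negation of the implication refutable; A12 and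
  A13 carry this refutation to the iterated exclusion, and A14 converts it into an implication.
  Backward, A11 is followed by monotonicity of disjunction.\<close>

lemma excl_residuated: "\<Gamma> \<turnstile>\<^sub>s \<phi> \<^bold>\<rightarrow> \<psi> \<^bold>\<or> \<chi> \<longleftrightarrow> \<Gamma> \<turnstile>\<^sub>s \<phi> \<^bold>\<prec> \<psi> \<^bold>\<rightarrow> \<chi>"
proof
  assume "\<Gamma> \<turnstile>\<^sub>s \<phi> \<^bold>\<rightarrow> \<psi> \<^bold>\<or> \<chi>"
  then have "\<Gamma> \<turnstile>\<^sub>s \<^bold>\<not> \<^bold>\<sim> (\<phi> \<^bold>\<rightarrow> \<psi> \<^bold>\<or> \<chi>)" by (rule sDN)
  \<comment> \<open>A negation is an implication into the bottom, so \<open>imp_trans\<close> acts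
    as contraposition.\<close>
  then have "\<Gamma> \<turnstile>\<^sub>s \<^bold>\<not> (\<phi> \<^bold>\<prec> (\<psi> \<^bold>\<or> \<chi>))" by (meson A12 Ax imp_trans)
  then have "\<Gamma> \<turnstile>\<^sub>s \<^bold>\<not> (\<phi> \<^bold>\<prec> \<psi> \<^bold>\<prec> \<chi>)" by (meson A13 Ax imp_trans)
  then show "\<Gamma> \<turnstile>\<^sub>s \<phi> \<^bold>\<prec> \<psi> \<^bold>\<rightarrow> \<chi>" by (meson A14 Ax MP)
next
  assume "\<Gamma> \<turnstile>\<^sub>s \<phi> \<^bold>\<prec> \<psi> \<^bold>\<rightarrow> \<chi>"
  then have "\<Gamma> \<turnstile>\<^sub>s \<psi> \<^bold>\<or> \<phi> \<^bold>\<prec> \<psi> \<^bold>\<rightarrow> \<psi> \<^bold>\<or> \<chi>"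
    by (meson disj_impI imp_disj1 imp_disj2 imp_trans)
  then show "\<Gamma> \<turnstile>\<^sub>s \<phi> \<^bold>\<rightarrow> \<psi> \<^bold>\<or> \<chi>" by (meson A11 Ax imp_trans)
qed

section \<open>Provable equivalence is a congruence\<close>

definition prov_eq :: "'p fm \<Rightarrow> 'p fm \<Rightarrow> bool" where
  "prov_eq \<phi> \<psi> \<longleftrightarrow> \<Gamma> \<turnstile>\<^sub>s \<phi> \<^bold>\<rightarrow> \<psi> \<and> \<Gamma> \<turnstile>\<^sub>s \<psi> \<^bold>\<rightarrow> \<phi>"

lemma equivp_prov_eq: "equivp prov_eq"
  by (rule equivpI; unfold reflp_def symp_def transp_def prov_eq_def)
    (blast intro: imp_refl imp_trans)+

text \<open>The four monotonicity lemmas (with \<open>Imp\<close> antitone on the left and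
  \<open>Excl\<close> antitone on the right) make \<open>prov_eq\<close> a congruence, so operations
  on classes do not depend on representatives.\<close>

lemma conj_mono:
  "\<lbrakk>\<Gamma> \<turnstile>\<^sub>s \<phi> \<^bold>\<rightarrow> \<phi>'; \<Gamma> \<turnstile>\<^sub>s \<psi> \<^bold>\<rightarrow> \<psi>'\<rbrakk> \<Longrightarrow> \<Gamma> \<turnstile>\<^sub>s \<phi> \<^bold>\<and> \<psi> \<^bold>\<rightarrow> \<phi>' \<^bold>\<and> \<psi>'"
  by (meson conj_imp1 conj_imp2 imp_conjI imp_trans)

lemma disj_mono:
  "\<lbrakk>\<Gamma> \<turnstile>\<^sub>s \<phi> \<^bold>\<rightarrow> \<phi>'; \<Gamma> \<turnstile>\<^sub>s \<psi> \<^bold>\<rightarrow> \<psi>'\<rbrakk> \<Longrightarrow> \<Gamma> \<turnstile>\<^sub>s \<phi> \<^bold>\<or> \<psi> \<^bold>\<rightarrow> \<phi>' \<^bold>\<or> \<psi>'"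
  by (meson imp_disj1 imp_disj2 disj_impI imp_trans)

lemma imp_mono:
  assumes "\<Gamma> \<turnstile>\<^sub>s \<phi>' \<^bold>\<rightarrow> \<phi>" "\<Gamma> \<turnstile>\<^sub>s \<psi> \<^bold>\<rightarrow> \<psi>'"
  shows "\<Gamma> \<turnstile>\<^sub>s (\<phi> \<^bold>\<rightarrow> \<psi>) \<^bold>\<rightarrow> (\<phi>' \<^bold>\<rightarrow> \<psi>')"
proof -
  have "\<Gamma> \<turnstile>\<^sub>s (\<phi> \<^bold>\<rightarrow> \<psi>) \<^bold>\<and> \<phi> \<^bold>\<rightarrow> \<psi>" by (simp add: imp_residuated imp_refl)
  then have "\<Gamma> \<turnstile>\<^sub>s (\<phi> \<^bold>\<rightarrow> \<psi>) \<^bold>\<and> \<phi>' \<^bold>\<rightarrow> \<psi>'"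
    using assms by (meson conj_mono imp_refl imp_trans)
  then show ?thesis by (simp add: imp_residuated)
qed

lemma excl_mono:
  assumes "\<Gamma> \<turnstile>\<^sub>s \<phi> \<^bold>\<rightarrow> \<phi>'" "\<Gamma> \<turnstile>\<^sub>s \<psi>' \<^bold>\<rightarrow> \<psi>"
  shows "\<Gamma> \<turnstile>\<^sub>s \<phi> \<^bold>\<prec> \<psi> \<^bold>\<rightarrow> \<phi>' \<^bold>\<prec> \<psi>'"
proof -
  \<comment> \<open>The unit of the residuation, obtained from reflexivity of implication.\<close>
  have "\<Gamma> \<turnstile>\<^sub>s \<phi>' \<^bold>\<rightarrow> \<psi>' \<^bold>\<or> \<phi>' \<^bold>\<prec> \<psi>'" by (simp add: excl_residuated imp_refl)
  then have "\<Gamma> \<turnstile>\<^sub>s \<phi> \<^bold>\<rightarrow> \<psi> \<^bold>\<or> \<phi>' \<^bold>\<prec> \<psi>'"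
    using assms by (meson disj_mono imp_refl imp_trans)
  then show ?thesis by (simp add: excl_residuated)
qed

end

section \<open>The Lindenbaum algebra\<close>

text \<open>The map \<open>f\<close> names the class of each formula by an element of the target type.\<close>

locale lindenbaum =
  fixes \<Gamma> :: "'p fm set" and f :: "'p fm \<Rightarrow> 'a"
  assumes f_eq_iff: "f \<phi> = f \<psi> \<longleftrightarrow> prov_eq \<Gamma> \<phi> \<psi>"
begin

text \<open>\<open>inv f\<close> picks a representative of a class, so the quotient operations live
  directly on \<open>'a\<close>; outside the range of \<open>f\<close> their values are
  arbitrary.\<close>

definition lift :: "('p fm \<Rightarrow> 'p fm \<Rightarrow> 'p fm) \<Rightarrow> 'a \<Rightarrow> 'a \<Rightarrow> 'a" where
  "lift c a b = f (c (inv f a) (inv f b))"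

definition alg :: "'a bi_alg" where
  "alg = \<lparr>carrier = range f, top_op = f \<^bold>\<top>, bot_op = f \<^bold>\<bottom>, meet_op = lift Conj,
    join_op = lift Disj, imp_op = lift Imp, excl_op = lift Excl\<rparr>"

lemma prov_eq_inv: "prov_eq \<Gamma> (inv f (f \<phi>)) \<phi>"
  by (simp add: f_eq_iff[symmetric] f_inv_into_f)

lemma alg_simps [simp]:
  "carrier alg = range f" "top_op alg = f \<^bold>\<top>" "bot_op alg = f \<^bold>\<bottom>"
  "meet_op alg (f \<phi>) (f \<psi>) = f (\<phi> \<^bold>\<and> \<psi>)" "join_op alg (f \<phi>) (f \<psi>) = f (\<phi> \<^bold>\<or> \<psi>)"
  "imp_op alg (f \<phi>) (f \<psi>) = f (\<phi> \<^bold>\<rightarrow> \<psi>)" "excl_op alg (f \<phi>) (f \<psi>) = f (\<phi> \<^bold>\<prec> \<psi>)"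
  using prov_eq_inv[of \<phi>] prov_eq_inv[of \<psi>]
  by (simp_all add: alg_def lift_def f_eq_iff prov_eq_def
      conj_mono disj_mono imp_mono excl_mono)

lemma alg_le_iff: "alg_le alg (f \<phi>) (f \<psi>) \<longleftrightarrow> \<Gamma> \<turnstile>\<^sub>s \<phi> \<^bold>\<rightarrow> \<psi>"
  unfolding alg_le_def alg_simps f_eq_iff prov_eq_def
  by (meson conj_imp1 conj_imp2 imp_conjI imp_refl imp_trans)

text \<open>The truth lemma for the canonical valuation, which sends each variable to its own
  class.\<close>

lemma eval_alg: "eval_fm alg (f \<circ> Var) \<phi> = f \<phi>"
  by (induction \<phi>) simp_all

text \<open>Weakening puts a consequence of \<Gamma> above the top; conversely the top is derivable
  and can be detached. With \<open>eval_alg\<close>, the canonical valuation thus refutes every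
  formula that \<Gamma> does not derive.\<close>

lemma eq_top_iff: "f \<phi> = f \<^bold>\<top> \<longleftrightarrow> \<Gamma> \<turnstile>\<^sub>s \<phi>"
  unfolding f_eq_iff prov_eq_def by (meson A10 Ax MP imp_refl imp_weaken)

lemma bi_heyting: "bi_heyting_algebra alg"
proof
  fix a b c assume "a \<in> carrier alg" "b \<in> carrier alg" "c \<in> carrier alg"
  \<comment> \<open>Every carrier element is the class of a formula, so each law unfolds to provable
    implications.\<close>
  then obtain \<phi> \<psi> \<chi> where abc: "a = f \<phi>" "b = f \<psi>" "c = f \<chi>" by auto
  show "meet_op alg (meet_op alg a b) c = meet_op alg a (meet_op alg b c)"
    unfolding abc alg_simps f_eq_iff prov_eq_def
    by (meson conj_imp1 conj_imp2 imp_conjI imp_trans)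
  show "join_op alg (join_op alg a b) c = join_op alg a (join_op alg b c)"
    unfolding abc alg_simps f_eq_iff prov_eq_def
    by (meson imp_disj1 imp_disj2 disj_impI imp_trans)
  show "alg_le alg (meet_op alg a b) c \<longleftrightarrow> alg_le alg a (imp_op alg b c)"
    unfolding abc alg_simps alg_le_iff by (rule imp_residuated)
  show "alg_le alg a (join_op alg b c) \<longleftrightarrow> alg_le alg (excl_op alg a b) c"
    unfolding abc alg_simps alg_le_iff by (rule excl_residuated)
next
  fix a b assume "a \<in> carrier alg" "b \<in> carrier alg"
  then obtain \<phi> \<psi> where ab: "a = f \<phi>" "b = f \<psi>" by auto
  show "meet_op alg a b \<in> carrier alg" "join_op alg a b \<in> carrier alg"
    "imp_op alg a b \<in> carrier alg" "excl_op alg a b \<in> carrier alg"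
    unfolding ab alg_simps by auto
  show "meet_op alg a b = meet_op alg b a"
    unfolding ab alg_simps f_eq_iff prov_eq_def by (meson conj_imp1 conj_imp2 imp_conjI)
  show "join_op alg a b = join_op alg b a"
    unfolding ab alg_simps f_eq_iff prov_eq_def by (meson imp_disj1 imp_disj2 disj_impI)
  show "meet_op alg a (join_op alg a b) = a"
    unfolding ab alg_simps f_eq_iff prov_eq_def
    by (meson conj_imp1 imp_conjI imp_disj1 imp_refl)
  show "join_op alg a (meet_op alg a b) = a"
    unfolding ab alg_simps f_eq_iff prov_eq_def
    by (meson conj_imp1 disj_impI imp_disj1 imp_refl)
next
  fix a assume "a \<in> carrier alg"
  then obtain \<phi> where a: "a = f \<phi>" by auto
  show "alg_le alg a (top_op alg)" "alg_le alg (bot_op alg) a"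
    unfolding a alg_simps alg_le_iff by (rule Ax, rule bi_axiom.intros)+
qed simp_all

end

section \<open>Countability and a copy of the quotient in an infinite type\<close>

instance fm :: (countable) countable
  by countable_datatype

lemma countable_fm:
  assumes "countable (UNIV :: 'p set)"
  shows "countable (UNIV :: 'p fm set)"
proof -
  obtain g :: "'p \<Rightarrow> nat" where "inj g" using assms by (auto simp: countable_def)
  \<comment> \<open>Countability of \<open>'p\<close> is a hypothesis and not a class constraint, so
    formulas are first renamed to formulas over \<open>nat\<close>, where the instance
    applies.\<close>
  then have "inj (map_fm g)" by (rule fm.inj_map)
  then have "inj (to_nat \<circ> map_fm g)" by (simp add: inj_compose)
  then show ?thesis by (auto simp: countable_def)
qed

text \<open>The naming map chooses a representative, codes it by a natural number and embeds the
  numbers into \<open>'a\<close>; the last two maps are injective, so only the choice identifies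
  formulas.\<close>

lemma ex_lindenbaum:
  assumes "countable (UNIV :: 'p set)" and "infinite (UNIV :: 'a set)"
  obtains f :: "'p fm \<Rightarrow> 'a" where "lindenbaum \<Gamma> f"
proof -
  obtain g :: "'p fm \<Rightarrow> nat" where g: "inj g"
    using countable_fm[OF assms(1)] by (auto simp: countable_def)
  obtain h :: "nat \<Rightarrow> 'a" where h: "inj h"
    using infinite_countable_subset[OF assms(2)] by auto
  define r where "r \<phi> = (SOME \<psi>. prov_eq \<Gamma> \<phi> \<psi>)" for \<phi>
  have r: "prov_eq \<Gamma> \<phi> (r \<phi>)" for \<phi>
    unfolding r_def by (rule someI[of _ \<phi>]) (simp add: equivp_reflp equivp_prov_eq)
  have "r \<phi> = r \<psi> \<longleftrightarrow> prov_eq \<Gamma> \<phi> \<psi>" for \<phi> \<psi>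
  proof
    assume "r \<phi> = r \<psi>"
    then show "prov_eq \<Gamma> \<phi> \<psi>"
      using r[of \<phi>] r[of \<psi>] equivp_prov_eq[of \<Gamma>] by (metis equivp_symp equivp_transp)
  next
    assume "prov_eq \<Gamma> \<phi> \<psi>"
    \<comment> \<open>Equivalent formulas give the same predicate, and \<open>SOME\<close> depends
      on nothing else.\<close>
    then have "prov_eq \<Gamma> \<phi> = prov_eq \<Gamma> \<psi>"
      using equivp_prov_eq[of \<Gamma>] by (simp add: equivp_def)
    then show "r \<phi> = r \<psi>" by (simp add: r_def)
  qed
  then have "lindenbaum \<Gamma> (\<lambda>\<phi>. h (g (r \<phi>)))"
    using g h by (simp add: lindenbaum_def inj_eq)
  then show ?thesis by (rule that)
qed

section \<open>Algebraizability\<close>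

text \<open>This is ALG1. For completeness a single model suffices for each \<Gamma>: its Lindenbaum
  algebra with the canonical valuation.\<close>

lemma sBIL_iff_entails:
  assumes "countable (UNIV :: 'p set)" and "infinite (UNIV :: 'a set)"
  shows "(\<Gamma> :: 'p fm set) \<turnstile>\<^sub>s \<phi> \<longleftrightarrow>
    entails (BHA :: 'a bi_alg set) ((\<lambda>\<gamma>. (\<gamma>, \<^bold>\<top>)) ` \<Gamma>) (\<phi>, \<^bold>\<top>)"
proof
  assume "\<Gamma> \<turnstile>\<^sub>s \<phi>"
  then show "entails (BHA :: 'a bi_alg set) ((\<lambda>\<gamma>. (\<gamma>, \<^bold>\<top>)) ` \<Gamma>) (\<phi>, \<^bold>\<top>)"
    unfolding entails_def BHA_def using bi_heyting_algebra.sBIL_sound by fastforce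
next
  assume e: "entails (BHA :: 'a bi_alg set) ((\<lambda>\<gamma>. (\<gamma>, \<^bold>\<top>)) ` \<Gamma>) (\<phi>, \<^bold>\<top>)"
  obtain f :: "'p fm \<Rightarrow> 'a" where "lindenbaum \<Gamma> f"
    using ex_lindenbaum[OF assms] .
  then interpret lindenbaum \<Gamma> f .
  have "alg \<in> BHA" using bi_heyting by (simp add: BHA_def)
  moreover have "\<forall>p. (f \<circ> Var) p \<in> carrier alg" by simp
  moreover have "\<forall>(\<theta>, \<eta>)\<in>(\<lambda>\<gamma>. (\<gamma>, \<^bold>\<top>)) ` \<Gamma>. eval_fm alg (f \<circ> Var) \<theta> = eval_fm alg (f \<circ> Var) \<eta>"
    unfolding eval_alg by (auto simp: eq_top_iff El)
  ultimately have "eval_fm alg (f \<circ> Var) \<phi> = eval_fm alg (f \<circ> Var) \<^bold>\<top>"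
    using e unfolding entails_def fst_conv snd_conv by blast
  then show "\<Gamma> \<turnstile>\<^sub>s \<phi>" by (simp only: eval_alg eq_top_iff)
qed

lemma entails_iff_entails_Iff:
  fixes \<epsilon> \<delta> :: "'p fm"
  shows "entails (BHA :: 'a bi_alg set) \<Theta> (\<epsilon>, \<delta>) \<longleftrightarrow>
    entails (BHA :: 'a bi_alg set) ((\<lambda>(\<theta>, \<eta>). (\<theta> \<^bold>\<leftrightarrow> \<eta>, \<^bold>\<top>)) ` \<Theta>) (\<epsilon> \<^bold>\<leftrightarrow> \<delta>, \<^bold>\<top>)"
proof -
  \<comment> \<open>The equivalence holds in each algebra under each valuation, so premises and
    conclusion can be exchanged one by one.\<close>
  have "eval_fm A v (\<theta> \<^bold>\<leftrightarrow> \<eta>) = eval_fm A v \<^bold>\<top> \<longleftrightarrow> eval_fm A v \<theta> = eval_fm A v \<eta>"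
    if "A \<in> BHA" "\<forall>p. v p \<in> carrier A" for A :: "'a bi_alg" and v and \<theta> \<eta> :: "'p fm"
    using that by (simp add: BHA_def bi_heyting_algebra.iff_eq_top_iff
        bi_heyting_algebra.eval_closed)
  then show ?thesis
    unfolding entails_def ball_simps split_beta fst_conv snd_conv
    by (intro ball_cong refl all_cong1 imp_cong) simp_all
qed

theorem mainTheorem2:
  fixes x y :: 'p
  assumes "countable (UNIV :: 'p set)" and "infinite (UNIV :: 'p set)"
    and "infinite (UNIV :: 'a set)"
    and "x \<noteq> y"
  shows "finitely_algebraizable sBIL (BHA :: 'a bi_alg set) x y
    {(Var x, \<^bold>\<top>)} {Var x \<^bold>\<leftrightarrow> Var y}"
proof -
  note alg1 = sBIL_iff_entails[OF assms(1,3)]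
  have eqs: "inst_eqs x {(Var x, \<^bold>\<top>)} \<phi> = {(\<phi>, \<^bold>\<top>)}" for \<phi> :: "'p fm"
    by (simp add: inst_eqs_def)
  have eqs_set: "inst_eqs_set x {(Var x, \<^bold>\<top>)} \<Gamma> = (\<lambda>\<gamma>. (\<gamma>, \<^bold>\<top>)) ` \<Gamma>" for \<Gamma> :: "'p fm set"
    by (auto simp: inst_eqs_set_def eqs)
  \<comment> \<open>Distinctness of \<open>x\<close> and \<open>y\<close> keeps the second update
    from overwriting the first.\<close>
  have fms: "inst_fms x y {Var x \<^bold>\<leftrightarrow> Var y} \<epsilon> \<delta> = {\<epsilon> \<^bold>\<leftrightarrow> \<delta>}" for \<epsilon> \<delta> :: "'p fm"
    using assms(4) by (simp add: inst_fms_def)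
  have fms_set: "inst_fms_set x y {Var x \<^bold>\<leftrightarrow> Var y} \<Theta> = (\<lambda>(\<epsilon>, \<delta>). \<epsilon> \<^bold>\<leftrightarrow> \<delta>) ` \<Theta>"
    for \<Theta> :: "'p equation set"
    by (auto simp: inst_fms_set_def fms)
  \<comment> \<open>ALG1 applied to the equations after their translation into biconditionals equal
    to the top.\<close>
  have alg2: "entails (BHA :: 'a bi_alg set) \<Theta> (\<epsilon>, \<delta>) \<longleftrightarrow>
      (\<lambda>(\<epsilon>, \<delta>). \<epsilon> \<^bold>\<leftrightarrow> \<delta>) ` \<Theta> \<turnstile>\<^sub>s \<epsilon> \<^bold>\<leftrightarrow> \<delta>" for \<Theta> and \<epsilon> \<delta> :: "'p fm"
    unfolding alg1 by (subst entails_iff_entails_Iff) (simp add: image_image split_beta)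
  \<comment> \<open>Through ALG1 both derivations become the statement that the biconditional of a
    value with the top is the top exactly when that value is.\<close>
  have alg3: "{\<phi>} \<turnstile>\<^sub>s \<phi> \<^bold>\<leftrightarrow> \<^bold>\<top>" "{\<phi> \<^bold>\<leftrightarrow> \<^bold>\<top>} \<turnstile>\<^sub>s \<phi>" for \<phi> :: "'p fm"
    unfolding alg1 entails_def BHA_def
    by (auto simp: bi_heyting_algebra.iff_eq_top_iff bi_heyting_algebra.eval_closed
        bi_heyting_algebra.top_closed)
  have alg4: "entails (BHA :: 'a bi_alg set) {(\<epsilon>, \<delta>)} (\<epsilon> \<^bold>\<leftrightarrow> \<delta>, \<^bold>\<top>)"
    "entails (BHA :: 'a bi_alg set) {(\<epsilon> \<^bold>\<leftrightarrow> \<delta>, \<^bold>\<top>)} (\<epsilon>, \<delta>)" for \<epsilon> \<delta> :: "'p fm"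
    unfolding entails_def BHA_def
    by (auto simp: bi_heyting_algebra.iff_eq_top_iff bi_heyting_algebra.eval_closed)
  show ?thesis
    unfolding finitely_algebraizable_def eqs eqs_set fms fms_set entails_set_def derives_set_def
    using assms(4) by (auto simp: alg1[symmetric] alg2[symmetric] alg3 alg4)
qed

end
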